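(* Let $\mathbf{F}=(F,\leq_\mathbf{F})$ be the countable universal homogeneous echeloned space and let $C=E(\mathbf{F})\setminus\{\bot_\mathbf{F}\}$. Then the $C$-coloured graph $(F,\chi)$ with $\chi\colon[F]^2\to C$, $\{u,v\}\mapsto\eta_\mathbf{F}(u,v)$, is isomorphic to $\mathcal{T}_C$, the universal homogeneous countable $C$-coloured graph (the Fraïssé limit of the class of all finite $C$-coloured graphs).
   Context: An echeloned space is a pair $\mathbf{X}=(X,\leq_\mathbf{X})$ where $X$ is a non-empty set and $\leq_\mathbf{X}$ is a total preorder on $X^2$ such that for all $x,y,z$: $(x,x)\leq_\mathbf{X}(y,z)$; $(y,z)\leq_\mathbf{X}(x,x)$ implies $y=z$; $(x,y)\leq_\mathbf{X}(y,x)$. Embeddings are injective maps $h$ with $(x_1,y_1)\leq_\mathbf{X}(x_2,y_2)\iff(h(x_1),h(y_1))\leq_\mathbf{Y}(h(x_2),h(y_2))$. The echeloning $E(\mathbf{X})$ is $X^2/\!\sim_\mathbf{X}$ ($p\sim_\mathbf{X}q$ iff $p\leq_\mathbf{X}q\leq_\mathbf{X}p$) linearly ordered by $[p]\leq[q]$ iff $p\leq_\mathbf{X}q$; $\eta_\mathbf{X}$ is the quotient map and $\bot_\mathbf{X}$ the least element of $E(\mathbf{X})$. $\mathbf{F}$ is the Fraïssé limit of the class of finite echeloned spaces. For a non-empty set $C$, a $C$-coloured graph is a pair $(V,\chi)$ with $\chi\colon[V]^2\to C$ ($[V]^2$ the set of $2$-element subsets of $V$); an embedding $(V_1,\chi_1)\to(V_2,\chi_2)$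 is an injective map $f$ with $\chi_2(\{f(x),f(y)\})=\chi_1(\{x,y\})$ for all $\{x,y\}\in[V_1]^2$. For countable $C$, the class of finite $C$-coloured graphs is a Fraïssé class. *)

theory Defs
  imports "HOL-Library.Ramsey" "HOL-Library.FuncSet" "HOL-Library.Countable_Set"
begin

section \<open>Echeloned spaces\<close>

text \<open>A structure is given by its carrier and its relation (or colouring). The relation \<open>R\<close> of an
  echeloned space lives on pairs of points: \<open>((x, y), (u, v)) \<in> R\<close> means $(x,y) \leq (u,v)$.\<close>

definition echeloned_space :: "'a set \<Rightarrow> ('a \<times> 'a) rel \<Rightarrow> bool" where
  "echeloned_space X R \<longleftrightarrow>
     X \<noteq> {} \<and> preorder_on (X \<times> X) R \<and> total_on (X \<times> X) R \<and>
     (\<forall>x\<in>X. \<forall>y\<in>X. \<forall>z\<in>X. ((x, x), (y, z)) \<in> R) \<and>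
     (\<forall>x\<in>X. \<forall>y\<in>X. \<forall>z\<in>X. ((y, z), (x, x)) \<in> R \<longrightarrow> y = z) \<and>
     (\<forall>x\<in>X. \<forall>y\<in>X. ((x, y), (y, x)) \<in> R)"

definition ech_embedding ::
  "'a set \<Rightarrow> ('a \<times> 'a) rel \<Rightarrow> 'b set \<Rightarrow> ('b \<times> 'b) rel \<Rightarrow> ('a \<Rightarrow> 'b) \<Rightarrow> bool" where
  "ech_embedding X R Y S h \<longleftrightarrow>
     h ` X \<subseteq> Y \<and> inj_on h X \<and>
     (\<forall>x1\<in>X. \<forall>y1\<in>X. \<forall>x2\<in>X. \<forall>y2\<in>X.
        ((x1, y1), (x2, y2)) \<in> R \<longleftrightarrow> ((h x1, h y1), (h x2, h y2)) \<in> S)"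

definition ech_isomorphism ::
  "'a set \<Rightarrow> ('a \<times> 'a) rel \<Rightarrow> 'b set \<Rightarrow> ('b \<times> 'b) rel \<Rightarrow> ('a \<Rightarrow> 'b) \<Rightarrow> bool" where
  "ech_isomorphism X R Y S h \<longleftrightarrow> ech_embedding X R Y S h \<and> h ` X = Y"

definition ech_homogeneous :: "'a set \<Rightarrow> ('a \<times> 'a) rel \<Rightarrow> bool" where
  "ech_homogeneous X R \<longleftrightarrow>
     (\<forall>A B f. A \<subseteq> X \<and> finite A \<and> B \<subseteq> X \<and> finite B \<and>
        ech_isomorphism A (Restr R (A \<times> A)) B (Restr R (B \<times> B)) f \<longrightarrow>
        (\<exists>g. ech_isomorphism X R X R g \<and> (\<forall>x\<in>A. g x = f x)))"

text \<open>Finite structures are taken with carriers in \<^typ>\<open>nat\<close>; this loses nothing, since every finite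
  structure is isomorphic to one of these.\<close>

definition ech_universal :: "'a set \<Rightarrow> ('a \<times> 'a) rel \<Rightarrow> bool" where
  "ech_universal X R \<longleftrightarrow>
     (\<forall>(Y :: nat set) S. finite Y \<and> echeloned_space Y S \<longrightarrow> (\<exists>h. ech_embedding Y S X R h))"

text \<open>The Fraisse limit of the class of finite echeloned spaces: countable, homogeneous, and with
  age the whole class. The other half of the age condition, that the finite non-empty
  substructures lie in the class, is automatic for an echeloned space.\<close>

definition ech_Fraisse_limit :: "'a set \<Rightarrow> ('a \<times> 'a) rel \<Rightarrow> bool" where
  "ech_Fraisse_limit X R \<longleftrightarrow>
     echeloned_space X R \<and> countable X \<and> ech_universal X R \<and> ech_homogeneous X R"

section \<open>The echeloning\<close>

definition ech_equiv :: "('a \<times> 'a) rel \<Rightarrow> ('a \<times> 'a) rel" where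
  "ech_equiv R = R \<inter> R\<inverse>"

definition echeloning :: "'a set \<Rightarrow> ('a \<times> 'a) rel \<Rightarrow> ('a \<times> 'a) set set" where
  "echeloning X R = (X \<times> X) // ech_equiv R"

definition ech_quot :: "('a \<times> 'a) rel \<Rightarrow> 'a \<times> 'a \<Rightarrow> ('a \<times> 'a) set" where
  "ech_quot R p = ech_equiv R `` {p}"

definition echeloning_order :: "('a \<times> 'a) rel \<Rightarrow> ('a \<times> 'a) set rel" where
  "echeloning_order R = {(ech_quot R p, ech_quot R q) | p q. (p, q) \<in> R}"

definition ech_bot :: "'a set \<Rightarrow> ('a \<times> 'a) rel \<Rightarrow> ('a \<times> 'a) set" where
  "ech_bot X R = (THE b. b \<in> echeloning X R \<and>
     (\<forall>c\<in>echeloning X R. (b, c) \<in> echeloning_order R))"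

section \<open>Coloured graphs\<close>

definition coloured_graph :: "'c set \<Rightarrow> 'a set \<Rightarrow> ('a set \<Rightarrow> 'c) \<Rightarrow> bool" where
  "coloured_graph C V \<chi> \<longleftrightarrow> C \<noteq> {} \<and> \<chi> \<in> nsets V 2 \<rightarrow> C"

definition cg_embedding ::
  "'a set \<Rightarrow> ('a set \<Rightarrow> 'c) \<Rightarrow> 'b set \<Rightarrow> ('b set \<Rightarrow> 'c) \<Rightarrow> ('a \<Rightarrow> 'b) \<Rightarrow> bool" where
  "cg_embedding V \<chi> W \<psi> f \<longleftrightarrow>
     f ` V \<subseteq> W \<and> inj_on f V \<and> (\<forall>x y. {x, y} \<in> nsets V 2 \<longrightarrow> \<psi> {f x, f y} = \<chi> {x, y})"

definition cg_isomorphism ::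
  "'a set \<Rightarrow> ('a set \<Rightarrow> 'c) \<Rightarrow> 'b set \<Rightarrow> ('b set \<Rightarrow> 'c) \<Rightarrow> ('a \<Rightarrow> 'b) \<Rightarrow> bool" where
  "cg_isomorphism V \<chi> W \<psi> f \<longleftrightarrow> cg_embedding V \<chi> W \<psi> f \<and> f ` V = W"

definition cg_isomorphic ::
  "'a set \<Rightarrow> ('a set \<Rightarrow> 'c) \<Rightarrow> 'b set \<Rightarrow> ('b set \<Rightarrow> 'c) \<Rightarrow> bool" where
  "cg_isomorphic V \<chi> W \<psi> \<longleftrightarrow> (\<exists>f. cg_isomorphism V \<chi> W \<psi> f)"

text \<open>\<^const>\<open>cg_isomorphism\<close> only inspects a colouring on the 2-element subsets of the carrier, so the
  subgraph induced on \<open>A\<close> is \<open>A\<close> with the same \<open>\<chi>\<close>.\<close>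

definition cg_homogeneous :: "'a set \<Rightarrow> ('a set \<Rightarrow> 'c) \<Rightarrow> bool" where
  "cg_homogeneous V \<chi> \<longleftrightarrow>
     (\<forall>A B f. A \<subseteq> V \<and> finite A \<and> B \<subseteq> V \<and> finite B \<and> cg_isomorphism A \<chi> B \<chi> f \<longrightarrow>
        (\<exists>g. cg_isomorphism V \<chi> V \<chi> g \<and> (\<forall>x\<in>A. g x = f x)))"

definition cg_universal :: "'c set \<Rightarrow> 'a set \<Rightarrow> ('a set \<Rightarrow> 'c) \<Rightarrow> bool" where
  "cg_universal C V \<chi> \<longleftrightarrow>
     (\<forall>(W :: nat set) \<psi>. finite W \<and> coloured_graph C W \<psi> \<longrightarrow> (\<exists>f. cg_embedding W \<psi> V \<chi> f))"

definition cg_Fraisse_limit :: "'c set \<Rightarrow> 'a set \<Rightarrow> ('a set \<Rightarrow> 'c) \<Rightarrow> bool" where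
  "cg_Fraisse_limit C V \<chi> \<longleftrightarrow>
     coloured_graph C V \<chi> \<and> countable V \<and> cg_universal C V \<chi> \<and> cg_homogeneous V \<chi>"

section \<open>The coloured graph of an echeloned space\<close>

definition ech_colours :: "'a set \<Rightarrow> ('a \<times> 'a) rel \<Rightarrow> ('a \<times> 'a) set set" where
  "ech_colours X R = echeloning X R - {ech_bot X R}"

text \<open>Well defined on 2-element subsets of the carrier, because $(u,v) \sim (v,u)$.\<close>

definition ech_colouring :: "('a \<times> 'a) rel \<Rightarrow> 'a set \<Rightarrow> ('a \<times> 'a) set" where
  "ech_colouring R e = (THE c. \<exists>u v. e = {u, v} \<and> u \<noteq> v \<and> c = ech_quot R (u, v))"

end

theory Submission
  imports Defs
begin

text \<open>Every colour of the graph is the class of a pair of distinct points of \<open>F\<close>. Given finitely many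
  points with prescribed colours, enlarge them by representatives of these colours; the abstract
  one-point extension with the prescribed classes is then a finite echeloned space having no new
  classes. Universality embeds it into \<open>F\<close> and homogeneity moves it back over the given points,
  so \<open>F\<close> has the one-point extension property of coloured graphs. By back-and-forth, this property
  characterises the countable universal homogeneous coloured graph.\<close>

section \<open>Coloured graphs with the extension property\<close>

definition cg_extension :: "'c set \<Rightarrow> 'a set \<Rightarrow> ('a set \<Rightarrow> 'c) \<Rightarrow> bool" where
  "cg_extension C V \<chi> \<longleftrightarrow>
     (\<forall>A c. finite A \<and> A \<subseteq> V \<and> c \<in> A \<rightarrow> C \<longrightarrow> (\<exists>z\<in>V - A. \<forall>a\<in>A. \<chi> {a, z} = c a))"

text \<open>A relation instead of a map with a domain makes inverses and unions of chains immediate.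
  The clause \<open>x = x' \<longleftrightarrow> y = y'\<close> covers single-valuedness and
  injectivity at once.\<close>

definition cg_partial_iso ::
  "'a set \<Rightarrow> ('a set \<Rightarrow> 'c) \<Rightarrow> 'b set \<Rightarrow> ('b set \<Rightarrow> 'c) \<Rightarrow> ('a \<times> 'b) set \<Rightarrow> bool" where
  "cg_partial_iso V \<chi> W \<psi> P \<longleftrightarrow> P \<subseteq> V \<times> W \<and>
     (\<forall>x y x' y'. (x, y) \<in> P \<and> (x', y') \<in> P \<longrightarrow>
        (x = x' \<longleftrightarrow> y = y') \<and> (x \<noteq> x' \<longrightarrow> \<chi> {x, x'} = \<psi> {y, y'}))"

lemma cg_partial_iso_converse:
  "cg_partial_iso V \<chi> W \<psi> P \<Longrightarrow> cg_partial_iso W \<psi> V \<chi> (P\<inverse>)"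
  unfolding cg_partial_iso_def by (auto 0 3; metis)

text \<open>Prescribe for each point in the range of \<open>P\<close> the colour that its preimage
  has with \<open>v\<close>. The extension property of the target realises these colours by a new
  point, which becomes the image of \<open>v\<close>.\<close>

lemma cg_partial_iso_forth:
  assumes ext: "cg_extension C W \<psi>" and V: "coloured_graph C V \<chi>"
    and P: "cg_partial_iso V \<chi> W \<psi> P" "finite P" and v: "v \<in> V"
  shows "\<exists>P'. cg_partial_iso V \<chi> W \<psi> P' \<and> finite P' \<and> P \<subseteq> P' \<and> v \<in> Domain P'"
proof (cases "v \<in> Domain P")
  case True
  then show ?thesis using P by blast
next
  case False
  \<comment> \<open>Injectivity of \<open>P\<close> makes the preimage of \<open>b\<close> unique;
    off the range of \<open>P\<close> the value is arbitrary.\<close>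
  define c where "c b = \<chi> {THE x. (x, b) \<in> P, v}" for b
  have c: "c b = \<chi> {x, v}" if "(x, b) \<in> P" for x b
  proof -
    have "(THE x. (x, b) \<in> P) = x"
      using P(1) that unfolding cg_partial_iso_def by blast
    then show ?thesis by (simp add: c_def)
  qed
  have "c b \<in> C" if b: "b \<in> Range P" for b
  proof -
    obtain x where x: "(x, b) \<in> P" using b by blast
    then have "{x, v} \<in> nsets V 2"
      using P(1) v False unfolding cg_partial_iso_def by auto
    then show ?thesis using V c[OF x] unfolding coloured_graph_def by auto
  qed
  then have "finite (Range P) \<and> Range P \<subseteq> W \<and> c \<in> Range P \<rightarrow> C"
    using P unfolding cg_partial_iso_def by (auto simp: finite_Range)
  then obtain w where w: "w \<in> W - Range P" "\<forall>b\<in>Range P. \<psi> {b, w} = c b"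
    using ext[unfolded cg_extension_def, rule_format, of "Range P" c] by auto
  have vw: "\<chi> {x, v} = \<psi> {y, w}" if "(x, y) \<in> P" for x y
    using w(2) c[OF that] that by (metis RangeI)
  have "cg_partial_iso V \<chi> W \<psi> (insert (v, w) P)"
    unfolding cg_partial_iso_def
  proof (intro conjI allI impI, goal_cases)
    case 1
    then show ?case using P(1) v w(1) unfolding cg_partial_iso_def by auto
  next
    case (2 x y x' y')
    then show ?case using P(1) w(1) False unfolding cg_partial_iso_def by blast
  next
    case (3 x y x' y')
    then consider "(x, y) \<in> P" "(x', y') \<in> P" | "(x, y) \<in> P" "x' = v" "y' = w"
      | "x = v" "y = w" "(x', y') \<in> P" by auto
    then show ?case
    proof cases
      case 1
      then show ?thesis using P(1) 3(2) unfolding cg_partial_iso_def by blast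
    next
      case 2
      then show ?thesis using vw by simp
    next
      case 3
      then show ?thesis using vw[OF 3(3)] by (metis insert_commute)
    qed
  qed
  then show ?thesis using P(2) by blast
qed

lemma cg_partial_iso_back:
  assumes "cg_extension C V \<chi>" "coloured_graph C W \<psi>"
    and "cg_partial_iso V \<chi> W \<psi> P" "finite P" "w \<in> W"
  shows "\<exists>P'. cg_partial_iso V \<chi> W \<psi> P' \<and> finite P' \<and> P \<subseteq> P' \<and> w \<in> Range P'"
proof -
  obtain Q where Q: "cg_partial_iso W \<psi> V \<chi> Q" "finite Q" "P\<inverse> \<subseteq> Q" "w \<in> Domain Q"
    using cg_partial_iso_forth[OF assms(1,2) cg_partial_iso_converse[OF assms(3)] _ assms(5)]
      assms(4) by (metis finite_converse)
  then have "cg_partial_iso V \<chi> W \<psi> (Q\<inverse>) \<and> finite (Q\<inverse>) \<and> P \<subseteq> Q\<inverse> \<and> w \<in> Range (Q\<inverse>)"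
    using cg_partial_iso_converse by auto
  then show ?thesis by blast
qed

lemma cg_partial_iso_embedding:
  assumes P: "cg_partial_iso V \<chi> W \<psi> P" and V: "V \<subseteq> Domain P"
  shows "\<exists>f. cg_embedding V \<chi> W \<psi> f \<and> (\<forall>x y. (x, y) \<in> P \<longrightarrow> f x = y)"
proof -
  define f where "f x = (THE y. (x, y) \<in> P)" for x
  have f: "f x = y" if "(x, y) \<in> P" for x y
    using P that unfolding f_def cg_partial_iso_def by blast
  then have fP: "(x, f x) \<in> P" if "x \<in> V" for x
    using V that by (metis DomainE subsetD)
  have "f ` V \<subseteq> W"
    using fP P unfolding cg_partial_iso_def by auto
  moreover have "inj_on f V"
    using fP P unfolding cg_partial_iso_def inj_on_def by metis
  moreover have "\<psi> {f x, f y} = \<chi> {x, y}" if "{x, y} \<in> nsets V 2" for x y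
    using fP[of x] fP[of y] P that unfolding cg_partial_iso_def by auto
  ultimately have "cg_embedding V \<chi> W \<psi> f"
    unfolding cg_embedding_def by blast
  then show ?thesis using f by blast
qed

lemma cg_partial_iso_graph:
  assumes "cg_embedding V \<chi> W \<psi> f" "A \<subseteq> V"
  shows "cg_partial_iso V \<chi> W \<psi> ((\<lambda>x. (x, f x)) ` A)"
proof -
  have "f x = f y \<longleftrightarrow> x = y" "x \<noteq> y \<longrightarrow> \<psi> {f x, f y} = \<chi> {x, y}" "f x \<in> W"
    if "x \<in> A" "y \<in> A" for x y
    using assms that unfolding cg_embedding_def by (auto simp: inj_on_eq_iff subset_iff)
  then show ?thesis
    using assms(2) unfolding cg_partial_iso_def by auto
qed

lemma cg_partial_iso_mono:
  "cg_partial_iso V \<chi> W \<psi> P \<Longrightarrow> V \<subseteq> V' \<Longrightarrow> W \<subseteq> W' \<Longrightarrow> cg_partial_iso V' \<chi> W' \<psi> P"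
  unfolding cg_partial_iso_def by blast

text \<open>The arbitrary finite start \<open>P0\<close> lets one back-and-forth serve twice: the
  graph of a finite isomorphism yields homogeneity, the empty relation yields uniqueness up to
  isomorphism.\<close>

lemma cg_partial_iso_extends:
  fixes V :: "'a set" and W :: "'b set"
  assumes "cg_extension C V \<chi>" "coloured_graph C V \<chi>" "countable V"
    and "cg_extension C W \<psi>" "coloured_graph C W \<psi>" "countable W"
    and P0: "cg_partial_iso V \<chi> W \<psi> P0" "finite P0"
  obtains f where "cg_isomorphism V \<chi> W \<psi> f" "\<And>x y. (x, y) \<in> P0 \<Longrightarrow> f x = y"
proof -
  \<comment> \<open>Only an inclusion, so that empty carriers are covered; values outside the
    carrier are skipped by the guards in \<open>step\<close>.\<close>
  obtain en :: "nat \<Rightarrow> 'a" where en: "V \<subseteq> range en"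
    using \<open>countable V\<close> by (metis range_from_nat_into empty_subsetI order_refl)
  obtain em :: "nat \<Rightarrow> 'b" where em: "W \<subseteq> range em"
    using \<open>countable W\<close> by (metis range_from_nat_into empty_subsetI order_refl)
  \<comment> \<open>The clause for \<open>n = 0\<close> anchors the chain at \<open>P0\<close>,
    since dependent choice keeps only a predicate for each stage.\<close>
  define good where "good n Q \<longleftrightarrow> cg_partial_iso V \<chi> W \<psi> Q \<and> finite Q \<and> (n = 0 \<longrightarrow> Q = P0)"
    for n :: nat and Q
  define step where "step n Q Q' \<longleftrightarrow> Q \<subseteq> Q' \<and> (en n \<in> V \<longrightarrow> en n \<in> Domain Q') \<and>
    (em n \<in> W \<longrightarrow> em n \<in> Range Q')" for n Q Q'
  have "\<exists>P. \<forall>n. good n (P n) \<and> step n (P n) (P (Suc n))"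
  proof (rule dependent_nat_choice)
    show "\<exists>Q. good 0 Q" using P0 by (auto simp: good_def)
  next
    fix Q n assume "good n Q"
    then have Q: "cg_partial_iso V \<chi> W \<psi> Q" "finite Q" by (auto simp: good_def)
    obtain Q1 where Q1: "cg_partial_iso V \<chi> W \<psi> Q1" "finite Q1" "Q \<subseteq> Q1"
        "en n \<in> V \<longrightarrow> en n \<in> Domain Q1"
      using cg_partial_iso_forth[OF assms(4,2) Q, of "en n"] Q by (cases "en n \<in> V") auto
    obtain Q2 where Q2: "cg_partial_iso V \<chi> W \<psi> Q2" "finite Q2" "Q1 \<subseteq> Q2"
        "em n \<in> W \<longrightarrow> em n \<in> Range Q2"
      using cg_partial_iso_back[OF assms(1,5) Q1(1,2), of "em n"] Q1 by (cases "em n \<in> W") auto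
    have "good (Suc n) Q2 \<and> step n Q Q2"
      using Q1 Q2 unfolding good_def step_def by blast
    then show "\<exists>Q2. good (Suc n) Q2 \<and> step n Q Q2" by blast
  qed
  then obtain P where gs: "\<And>n. good n (P n)" "\<And>n. step n (P n) (P (Suc n))" by blast
  have P: "\<And>n. cg_partial_iso V \<chi> W \<psi> (P n)" "P 0 = P0"
    "\<And>n. P n \<subseteq> P (Suc n)"
    "\<And>n. en n \<in> V \<Longrightarrow> en n \<in> Domain (P (Suc n))"
    "\<And>n. em n \<in> W \<Longrightarrow> em n \<in> Range (P (Suc n))"
    using gs unfolding good_def step_def by auto
  define U where "U = (\<Union>n. P n)"
  have mono: "P m \<subseteq> P n" if "m \<le> n" for m n
    using lift_Suc_mono_le[of P, OF P(3) that] .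
  \<comment> \<open>Apart from the inclusion in \<open>V \<times> W\<close>, being a partial
    isomorphism is a condition on two pairs at a time. Two pairs of \<open>U\<close> share a stage
    of the increasing chain, so the union inherits it.\<close>
  have common: "\<exists>n. p \<in> P n \<and> q \<in> P n" if pq: "p \<in> U" "q \<in> U" for p q
  proof -
    obtain m n where "p \<in> P m" "q \<in> P n" using pq unfolding U_def by blast
    then show ?thesis
      using mono[of m "max m n"] mono[of n "max m n"] by auto
  qed
  have U: "cg_partial_iso V \<chi> W \<psi> U"
    unfolding cg_partial_iso_def
  proof (intro conjI allI impI, goal_cases)
    case 1
    then show ?case using P(1) unfolding U_def cg_partial_iso_def by blast
  next
    case (2 x y x' y')
    then show ?case
      using common[of "(x, y)" "(x', y')"] P(1) unfolding cg_partial_iso_def by metis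
  next
    case (3 x y x' y')
    then show ?case
      using common[of "(x, y)" "(x', y')"] P(1) unfolding cg_partial_iso_def by metis
  qed
  have "V \<subseteq> Domain U" "W \<subseteq> Range U"
  proof -
    show "V \<subseteq> Domain U"
    proof
      fix v assume "v \<in> V"
      then obtain n where "v = en n" using en by blast
      then show "v \<in> Domain U" using P(4)[of n] \<open>v \<in> V\<close> unfolding U_def by blast
    qed
    show "W \<subseteq> Range U"
    proof
      fix w assume "w \<in> W"
      then obtain n where "w = em n" using em by blast
      then show "w \<in> Range U" using P(5)[of n] \<open>w \<in> W\<close> unfolding U_def by blast
    qed
  qed
  obtain f where f: "cg_embedding V \<chi> W \<psi> f" "\<And>x y. (x, y) \<in> U \<Longrightarrow> f x = y"
    using cg_partial_iso_embedding[OF U \<open>V \<subseteq> Domain U\<close>] by blast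
  have "W \<subseteq> f ` V"
  proof
    fix w assume "w \<in> W"
    then obtain v where "(v, w) \<in> U" using \<open>W \<subseteq> Range U\<close> by blast
    then show "w \<in> f ` V" using f(2) U unfolding cg_partial_iso_def by blast
  qed
  then have "cg_isomorphism V \<chi> W \<psi> f"
    using f(1) unfolding cg_isomorphism_def cg_embedding_def by blast
  moreover have "P0 \<subseteq> U" using P(2) unfolding U_def by blast
  ultimately show thesis using f(2) that by blast
qed

section \<open>The extension property against universality and homogeneity\<close>

lemma cg_extension_embedding:
  assumes ext: "cg_extension C V \<chi>" and W: "coloured_graph C W \<psi>" "finite W"
  shows "\<exists>f. cg_embedding W \<psi> V \<chi> f"
proof -
  \<comment> \<open>Forth steps alone exhaust a finite graph, one vertex at a time.\<close>
  have "\<exists>P. cg_partial_iso W \<psi> V \<chi> P \<and> finite P \<and> A \<subseteq> Domain P" if "finite A" "A \<subseteq> W" for A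
    using that
  proof (induction A rule: finite_induct)
    case empty
    show ?case by (intro exI[of _ "{}"]) (simp add: cg_partial_iso_def)
  next
    case (insert a A)
    then obtain P where "cg_partial_iso W \<psi> V \<chi> P" "finite P" "A \<subseteq> Domain P" by auto
    with cg_partial_iso_forth[OF ext W(1) this(1,2), of a] insert.prems show ?case
      by (metis Domain_mono insert_subset order_trans)
  qed
  then obtain P where "cg_partial_iso W \<psi> V \<chi> P" "W \<subseteq> Domain P" using W(2) by blast
  then show ?thesis by (metis cg_partial_iso_embedding)
qed

text \<open>Homogeneity is the back-and-forth of \<open>V\<close> with itself, started at the graph
  of the given finite isomorphism.\<close>

lemma cg_extension_imp_Fraisse_limit:
  assumes "cg_extension C V \<chi>" "coloured_graph C V \<chi>" "countable V"
  shows "cg_Fraisse_limit C V \<chi>"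
proof -
  have "cg_universal C V \<chi>"
    unfolding cg_universal_def using cg_extension_embedding assms(1) by blast
  moreover have "\<exists>g. cg_isomorphism V \<chi> V \<chi> g \<and> (\<forall>x\<in>A. g x = f x)"
    if A: "A \<subseteq> V" "finite A" "B \<subseteq> V" "cg_isomorphism A \<chi> B \<chi> f" for A B f
  proof -
    have "cg_embedding A \<chi> B \<chi> f" using A(4) unfolding cg_isomorphism_def by blast
    from cg_partial_iso_graph[OF this order_refl] A(1,3)
    have "cg_partial_iso V \<chi> V \<chi> ((\<lambda>x. (x, f x)) ` A)" by (rule cg_partial_iso_mono)
    from cg_partial_iso_extends[OF assms assms this] A(2)
    obtain g where "cg_isomorphism V \<chi> V \<chi> g"
        "\<And>x y. (x, y) \<in> (\<lambda>x. (x, f x)) ` A \<Longrightarrow> g x = y"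
      by auto
    then show ?thesis by auto
  qed
  ultimately show ?thesis
    using assms(2,3) unfolding cg_Fraisse_limit_def cg_homogeneous_def by blast
qed

text \<open>\<open>cg_universal\<close> quantifies over carriers in \<open>nat\<close>, while the
  next argument embeds a graph on an option type. An injection into \<open>nat\<close> transports
  the colouring along its inverse.\<close>

lemma cg_universal_embedding:
  fixes W :: "'d set"
  assumes "cg_universal C V \<chi>" "coloured_graph C W \<psi>" "finite W"
  shows "\<exists>f. cg_embedding W \<psi> V \<chi> f"
proof -
  obtain e :: "'d \<Rightarrow> nat" where e: "inj_on e W"
    using finite_imp_inj_to_nat_seg[OF assms(3)] by blast
  define d where "d = inv_into W e"
  have d: "d (e x) = x" if "x \<in> W" for x
    using e that by (simp add: d_def)
  have "d ` S \<in> nsets W 2" if "S \<in> nsets (e ` W) 2" for S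
    using that by (rule nsets2_E) (auto simp: d)
  then have "coloured_graph C (e ` W) (\<lambda>S. \<psi> (d ` S))"
    using assms(2) unfolding coloured_graph_def by auto
  then obtain h where h: "cg_embedding (e ` W) (\<lambda>S. \<psi> (d ` S)) V \<chi> h"
    using assms(1,3) unfolding cg_universal_def by blast
  have "cg_embedding W \<psi> V \<chi> (h \<circ> e)"
    using h e d unfolding cg_embedding_def
    by (auto simp: inj_on_eq_iff[OF e] intro: comp_inj_on)
  then show ?thesis by blast
qed

text \<open>Adjoin to \<open>A\<close> an abstract vertex \<open>None\<close> with the colours
  \<open>c\<close> and embed the result by universality. By homogeneity an automorphism
  \<open>g\<close> carries \<open>A\<close> onto its embedded copy; the preimage under
  \<open>g\<close> of the image of \<open>None\<close> is the wanted vertex.\<close>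

lemma cg_Fraisse_limit_imp_extension:
  fixes V :: "'a set"
  assumes lim: "cg_Fraisse_limit C V \<chi>"
  shows "cg_extension C V \<chi>"
  unfolding cg_extension_def
proof (intro allI impI, elim conjE)
  fix A c assume A: "finite A" "A \<subseteq> V" "c \<in> A \<rightarrow> C"
  let ?W = "insert None (Some ` A)"
  \<comment> \<open>The copies \<open>Some x\<close> keep the colours of \<open>A\<close>. In an
    edge through \<open>None\<close>, the other endpoint is what remains after \<open>None\<close>
    is removed.\<close>
  define \<psi> where "\<psi> S = (if None \<in> S then c (the_elem (the ` (S - {None}))) else \<chi> (the ` S))" for S
  have \<psi>: "\<psi> {Some x, None} = c x" "\<psi> {Some x, Some y} = \<chi> {x, y}" for x y
    by (auto simp: \<psi>_def insert_Diff_if)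
  have "\<psi> S \<in> C" if S: "S \<in> nsets ?W 2" for S
  proof -
    obtain x y where xy: "S = {x, y}" "x \<in> ?W" "y \<in> ?W" "x \<noteq> y"
      using S by (rule nsets2_E)
    then consider x' where "S = {Some x', None}" "x' \<in> A"
      | x' y' where "S = {Some x', Some y'}" "x' \<in> A" "y' \<in> A" "x' \<noteq> y'"
      by (auto simp: insert_commute)
    then show ?thesis
    proof cases
      case 1
      then show ?thesis using A \<psi> by auto
    next
      case 2
      then have "{x', y'} \<in> nsets V 2" using A by auto
      then show ?thesis
        using lim \<psi> 2 unfolding cg_Fraisse_limit_def coloured_graph_def by auto
    qed
  qed
  then have "coloured_graph C ?W \<psi>"
    using lim unfolding cg_Fraisse_limit_def coloured_graph_def by auto
  then obtain h where h: "cg_embedding ?W \<psi> V \<chi> h"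
    using cg_universal_embedding lim A(1) unfolding cg_Fraisse_limit_def
    by (metis finite_imageI finite_insert)
  have hA: "\<chi> {h (Some x), h (Some y)} = \<chi> {x, y}" if "x \<in> A" "y \<in> A" "x \<noteq> y" for x y
    using h that \<psi> unfolding cg_embedding_def by simp
  have hN: "\<chi> {h (Some x), h None} = c x" if "x \<in> A" for x
    using h that \<psi> unfolding cg_embedding_def by simp
  have hV: "h ` ?W \<subseteq> V" and inj: "inj_on h ?W"
    using h unfolding cg_embedding_def by auto
  have "cg_isomorphism A \<chi> ((h \<circ> Some) ` A) \<chi> (h \<circ> Some)"
    using hA inj unfolding cg_isomorphism_def cg_embedding_def inj_on_def by auto
  moreover have "(h \<circ> Some) ` A \<subseteq> V" "finite ((h \<circ> Some) ` A)" using hV A(1) by auto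
  ultimately obtain g where g: "cg_isomorphism V \<chi> V \<chi> g" "\<forall>x\<in>A. g x = (h \<circ> Some) x"
    using lim A unfolding cg_Fraisse_limit_def cg_homogeneous_def by metis
  have "h None \<in> g ` V" using g(1) hV unfolding cg_isomorphism_def by auto
  then obtain z where z: "z \<in> V" "g z = h None" by auto
  have zA: "z \<notin> A"
  proof
    assume "z \<in> A"
    then have "h None = h (Some z)" using z(2) g(2) by simp
    with inj \<open>z \<in> A\<close> show False by (simp add: inj_on_eq_iff)
  qed
  have "\<chi> {a, z} = c a" if "a \<in> A" for a
  proof -
    have "{a, z} \<in> nsets V 2" using that zA z(1) A(2) by auto
    then have "\<chi> {a, z} = \<chi> {g a, g z}"
      using g(1) unfolding cg_isomorphism_def cg_embedding_def by metis
    then show ?thesis using g(2) z(2) hN that by simp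
  qed
  then show "\<exists>z\<in>V - A. \<forall>a\<in>A. \<chi> {a, z} = c a" using z(1) zA by blast
qed

section \<open>The extension property of the Fraisse limit\<close>

text \<open>Pairs are compared through \<open>p\<close>, which need not come from a map of points.
  The total preorder is inherited; since exactly the diagonal pairs go to diagonal pairs, so are the
  two axioms on the diagonal, and \<open>sym\<close> gives the last axiom.\<close>

lemma ech_pullback:
  assumes X: "echeloned_space X R" and Y: "Y \<noteq> {}"
    and p: "\<And>x y. x \<in> Y \<Longrightarrow> y \<in> Y \<Longrightarrow> p x y \<in> X \<times> X"
    and diag: "\<And>x y. x \<in> Y \<Longrightarrow> y \<in> Y \<Longrightarrow> fst (p x y) = snd (p x y) \<longleftrightarrow> x = y"
    and sym: "\<And>x y. x \<in> Y \<Longrightarrow> y \<in> Y \<Longrightarrow> (p x y, p y x) \<in> R"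
  shows "echeloned_space Y {((x, y), (x', y')). x \<in> Y \<and> y \<in> Y \<and> x' \<in> Y \<and> y' \<in> Y \<and>
    (p x y, p x' y') \<in> R}" (is "echeloned_space Y ?S")
proof -
  have R: "refl_on (X \<times> X) R" "trans R" "total_on (X \<times> X) R"
    using X unfolding echeloned_space_def preorder_on_def by auto
  have tot: "(u, v) \<in> R \<or> (v, u) \<in> R" if "u \<in> X \<times> X" "v \<in> X \<times> X" for u v
    using R that unfolding refl_on_def total_on_def by metis
  have "(p x y, p x y) \<in> R" if "x \<in> Y" "y \<in> Y" for x y
    using R(1) p that unfolding refl_on_def by blast
  then have "preorder_on (Y \<times> Y) ?S"
    unfolding preorder_on_def refl_on_def
    by (auto intro!: transI dest: transD[OF R(2)])
  moreover have "total_on (Y \<times> Y) ?S"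
    using tot p unfolding total_on_def by auto
  moreover have "((x, x), (y, z)) \<in> ?S" if "x \<in> Y" "y \<in> Y" "z \<in> Y" for x y z
    using X p[of x x] p[of y z] diag[of x x] that unfolding echeloned_space_def
    by (cases "p x x"; cases "p y z") auto
  moreover have "y = z" if "((y, z), (x, x)) \<in> ?S" for x y z
    using X p[of x x] p[of y z] diag[of x x] diag[of y z] that unfolding echeloned_space_def
    by (cases "p x x"; cases "p y z") auto
  moreover have "((x, y), (y, x)) \<in> ?S" if "x \<in> Y" "y \<in> Y" for x y
    using sym that by auto
  ultimately show ?thesis using Y unfolding echeloned_space_def by blast
qed

text \<open>As for coloured graphs, the carrier is moved into \<open>nat\<close>; the order moves
  with it as the pullback along \<open>d\<close> applied to both coordinates.\<close>

lemma ech_universal_embedding: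
  fixes Y :: "'d set"
  assumes "ech_universal X R" "echeloned_space Y S" "finite Y"
  shows "\<exists>h. ech_embedding Y S X R h"
proof -
  obtain e :: "'d \<Rightarrow> nat" where e: "inj_on e Y"
    using finite_imp_inj_to_nat_seg[OF assms(3)] by blast
  define d where "d = inv_into Y e"
  have d: "d (e x) = x" if "x \<in> Y" for x
    using e that by (simp add: d_def)
  define T where "T = {((x, y), (x', y')). x \<in> e ` Y \<and> y \<in> e ` Y \<and> x' \<in> e ` Y \<and> y' \<in> e ` Y \<and>
    ((d x, d y), (d x', d y')) \<in> S}"
  have "echeloned_space (e ` Y) T"
    unfolding T_def
    using assms(2) by (intro ech_pullback[OF assms(2)]) (auto simp: echeloned_space_def d)
  then obtain h where h: "ech_embedding (e ` Y) T X R h"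
    using assms(1,3) unfolding ech_universal_def by blast
  have "ech_embedding Y S X R (h \<circ> e)"
    using h e d unfolding ech_embedding_def inj_on_def by (auto simp: T_def)
  then show ?thesis by blast
qed

section \<open>Colours as classes of pairs of distinct points\<close>

context
  fixes F :: "'a set" and R :: "('a \<times> 'a) rel"
  assumes ech: "echeloned_space F R"
begin

lemma ech_trans: "(p, q) \<in> R \<Longrightarrow> (q, r) \<in> R \<Longrightarrow> (p, r) \<in> R"
  using ech unfolding echeloned_space_def preorder_on_def by (meson transD)

lemma ech_quot_eq_iff:
  assumes "p \<in> F \<times> F" "q \<in> F \<times> F"
  shows "ech_quot R p = ech_quot R q \<longleftrightarrow> (p, q) \<in> R \<and> (q, p) \<in> R"
proof -
  have "(q, q) \<in> R"
    using ech assms unfolding echeloned_space_def preorder_on_def refl_on_def by auto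
  then show ?thesis
    using ech_trans unfolding ech_quot_def ech_equiv_def by blast
qed

text \<open>Diagonal pairs lie below all pairs, and only diagonal pairs lie below a diagonal pair.
  So the diagonal is a single class, and it is the unique least one.\<close>

lemma ech_bot_eq:
  assumes x: "x \<in> F"
  shows "ech_bot F R = ech_quot R (x, x)"
  unfolding ech_bot_def
proof (rule the_equality, intro conjI ballI)
  show "ech_quot R (x, x) \<in> echeloning F R"
    using x unfolding echeloning_def ech_quot_def quotient_def by auto
next
  fix c assume "c \<in> echeloning F R"
  then obtain y z where "c = ech_quot R (y, z)" "y \<in> F" "z \<in> F"
    unfolding echeloning_def ech_quot_def quotient_def by auto
  then show "(ech_quot R (x, x), c) \<in> echeloning_order R"
    using ech x unfolding echeloning_order_def echeloned_space_def by blast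
next
  fix b assume b: "b \<in> echeloning F R \<and> (\<forall>c\<in>echeloning F R. (b, c) \<in> echeloning_order R)"
  then obtain y z where yz: "b = ech_quot R (y, z)" "y \<in> F" "z \<in> F"
    unfolding echeloning_def ech_quot_def quotient_def by auto
  have "ech_quot R (x, x) \<in> echeloning F R"
    using x unfolding echeloning_def ech_quot_def quotient_def by auto
  then have "(b, ech_quot R (x, x)) \<in> echeloning_order R" using b by blast
  \<comment> \<open>\<open>echeloning_order\<close> relates classes through some representatives;
    transitivity carries the relation over to \<open>(y, z)\<close> and
    \<open>(x, x)\<close>.\<close>
  then obtain p q where pq: "b = ech_quot R p" "ech_quot R (x, x) = ech_quot R q" "(p, q) \<in> R"
    unfolding echeloning_order_def by auto
  have "p \<in> F \<times> F" "q \<in> F \<times> F"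
    using ech pq(3) unfolding echeloned_space_def preorder_on_def refl_on_def by auto
  then have "((y, z), p) \<in> R" "(q, (x, x)) \<in> R"
    using ech_quot_eq_iff[of "(y, z)" p] ech_quot_eq_iff[of "(x, x)" q] pq yz x by simp_all
  then have "((y, z), (x, x)) \<in> R"
    using pq(3) ech_trans by blast
  then have "y = z" using ech yz x unfolding echeloned_space_def by blast
  then show "b = ech_quot R (x, x)"
    using ech yz x ech_quot_eq_iff[of "(y, z)" "(x, x)"] unfolding echeloned_space_def by auto
qed

text \<open>The pairs in the bottom class are exactly the diagonal ones. Hence a colour can be
  represented by two distinct points, as the one-point extension demands.\<close>

lemma ech_colours_eq:
  "ech_colours F R = {ech_quot R (x, y) | x y. x \<in> F \<and> y \<in> F \<and> x \<noteq> y}"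
proof -
  obtain x0 where x0: "x0 \<in> F" using ech unfolding echeloned_space_def by blast
  have 1: "echeloning F R = {ech_quot R (x, y) | x y. x \<in> F \<and> y \<in> F}"
    unfolding echeloning_def ech_quot_def quotient_def by auto
  have 2: "ech_quot R (x, y) = ech_bot F R \<longleftrightarrow> x = y" if "x \<in> F" "y \<in> F" for x y
    using ech that x0 unfolding ech_bot_eq[OF x0] echeloned_space_def
    by (subst ech_quot_eq_iff) auto
  show ?thesis
    unfolding ech_colours_def 1
  proof (rule set_eqI)
    fix c
    show "c \<in> {ech_quot R (x, y) | x y. x \<in> F \<and> y \<in> F} - {ech_bot F R} \<longleftrightarrow>
        c \<in> {ech_quot R (x, y) | x y. x \<in> F \<and> y \<in> F \<and> x \<noteq> y}"
      using 2 unfolding Diff_iff mem_Collect_eq singleton_iff by metis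
  qed
qed

lemma ech_quot_commute:
  "x \<in> F \<Longrightarrow> y \<in> F \<Longrightarrow> ech_quot R (x, y) = ech_quot R (y, x)"
  using ech unfolding echeloned_space_def by (subst ech_quot_eq_iff) auto

lemma ech_colouring_eq:
  assumes "x \<in> F" "y \<in> F" "x \<noteq> y"
  shows "ech_colouring R {x, y} = ech_quot R (x, y)"
  unfolding ech_colouring_def
  using assms ech_quot_commute[of x y]
  by (intro the_equality) (auto simp: doubleton_eq_iff)

text \<open>The two points witness that the set of colours is non-empty.\<close>

lemma ech_coloured_graph:
  assumes "x \<in> F" "y \<in> F" "x \<noteq> y"
  shows "coloured_graph (ech_colours F R) F (ech_colouring R)"
proof -
  have "ech_colouring R S \<in> ech_colours F R" if "S \<in> nsets F 2" for S
  proof -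
    obtain u v where "S = {u, v}" "u \<in> F" "v \<in> F" "u \<noteq> v"
      using \<open>S \<in> nsets F 2\<close> by (rule nsets2_E)
    then show ?thesis unfolding ech_colours_eq using ech_colouring_eq by auto
  qed
  moreover have "ech_colours F R \<noteq> {}" using assms unfolding ech_colours_eq by blast
  ultimately show ?thesis unfolding coloured_graph_def by blast
qed

section \<open>Realising prescribed classes over a finite set\<close>

text \<open>The pairs of the new point with \<open>b\<close> are ordered like \<open>r b\<close>,
  and \<open>r b\<close> is off the diagonal because the new point differs from \<open>b\<close>. It
  lies in \<open>B \<times> B\<close> because the automorphism obtained from homogeneity is
  controlled only on \<open>B\<close>, and \<open>(b, z)\<close> has to be compared with
  \<open>r b\<close> through it.\<close>

lemma ech_one_point_extension:
  assumes univ: "ech_universal F R" and hom: "ech_homogeneous F R"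
    and B: "finite B" "B \<subseteq> F" "b0 \<in> B"
    and r: "\<And>b. b \<in> B \<Longrightarrow> r b \<in> B \<times> B" "\<And>b. b \<in> B \<Longrightarrow> fst (r b) \<noteq> snd (r b)"
  obtains z where "z \<in> F - B" "\<And>b. b \<in> B \<Longrightarrow> ech_quot R (b, z) = ech_quot R (r b)"
proof -
  let ?Y = "insert None (Some ` B)"
  \<comment> \<open>Both orders of a mixed pair get the same value, which gives symmetry;
    \<open>(b0, b0)\<close> puts the pair of \<open>None\<close> with itself into the bottom
    class.\<close>
  define p where "p x y = (case (x, y) of (Some x, Some y) \<Rightarrow> (x, y) | (Some x, None) \<Rightarrow> r x
    | (None, Some y) \<Rightarrow> r y | (None, None) \<Rightarrow> (b0, b0))" for x y
  have p: "p (Some x) (Some y) = (x, y)" "p (Some x) None = r x" "p None (Some y) = r y"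
    "p None None = (b0, b0)" for x y
    by (simp_all add: p_def)
  define S where "S = {((x, y), (x', y')). x \<in> ?Y \<and> y \<in> ?Y \<and> x' \<in> ?Y \<and> y' \<in> ?Y \<and>
    (p x y, p x' y') \<in> R}"
  have rF: "r b \<in> F \<times> F" if "b \<in> B" for b using r(1)[OF that] B(2) by auto
  have refl: "(q, q) \<in> R" if "q \<in> F \<times> F" for q
    using ech that unfolding echeloned_space_def preorder_on_def refl_on_def by auto
  have sym: "((x, y), (y, x)) \<in> R" if "x \<in> F" "y \<in> F" for x y
    using ech that unfolding echeloned_space_def by auto
  have "echeloned_space ?Y S"
    unfolding S_def
  proof (rule ech_pullback[OF ech])
    fix x y assume xy: "x \<in> ?Y" "y \<in> ?Y"
    show "p x y \<in> F \<times> F" using xy B rF by (auto simp: p)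
    show "fst (p x y) = snd (p x y) \<longleftrightarrow> x = y" using xy B r(2) by (auto simp: p)
    show "(p x y, p y x) \<in> R"
      using xy B refl[OF rF] refl[of "(b0, b0)"] sym by (auto simp: p subset_iff)
  qed simp
  then obtain h where h: "ech_embedding ?Y S F R h"
    using ech_universal_embedding[OF univ] B(1) by blast
  have hV: "h ` ?Y \<subseteq> F" and inj: "inj_on h ?Y"
    using h unfolding ech_embedding_def by auto
  have hR: "((h x, h y), (h x', h y')) \<in> R \<longleftrightarrow> (p x y, p x' y') \<in> R"
    if "x \<in> ?Y" "y \<in> ?Y" "x' \<in> ?Y" "y' \<in> ?Y" for x y x' y'
  proof -
    have "((x, y), (x', y')) \<in> S \<longleftrightarrow> (p x y, p x' y') \<in> R"
      unfolding S_def using that by blast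
    then show ?thesis
      using h[unfolded ech_embedding_def, THEN conjunct2, THEN conjunct2, rule_format, OF that]
      by blast
  qed
  \<comment> \<open>On pairs of old points \<open>p\<close> is the identity, so the abstract order
    restricts to that of \<open>B\<close>, and \<open>?k\<close> is an isomorphism onto a finite
    subspace of \<open>F\<close>.\<close>
  let ?k = "h \<circ> Some"
  have "ech_isomorphism B (Restr R (B \<times> B)) (?k ` B) (Restr R (?k ` B \<times> ?k ` B)) ?k"
    unfolding ech_isomorphism_def ech_embedding_def
    using inj by (auto simp: inj_on_def hR p)
  moreover have "?k ` B \<subseteq> F" "finite (?k ` B)" using hV B by auto
  ultimately obtain g where g: "ech_isomorphism F R F R g" "\<forall>x\<in>B. g x = ?k x"
    using hom B unfolding ech_homogeneous_def by metis
  have "h None \<in> g ` F" using g(1) hV unfolding ech_isomorphism_def by auto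
  then obtain z where z: "z \<in> F" "g z = h None" by auto
  have zB: "z \<notin> B"
  proof
    assume "z \<in> B"
    then have "h None = h (Some z)" using z(2) g(2) by simp
    with inj \<open>z \<in> B\<close> show False by (simp add: inj_on_eq_iff)
  qed
  have gR: "((x, y), (x', y')) \<in> R \<longleftrightarrow> ((g x, g y), (g x', g y')) \<in> R"
    if "x \<in> F" "y \<in> F" "x' \<in> F" "y' \<in> F" for x y x' y'
    using g(1) that unfolding ech_isomorphism_def ech_embedding_def by metis
  have "ech_quot R (b, z) = ech_quot R (r b)" if b: "b \<in> B" for b
  proof -
    obtain u v where uv: "r b = (u, v)" "u \<in> B" "v \<in> B" using r(1)[OF b] by auto
    have F: "b \<in> F" "u \<in> F" "v \<in> F" using b uv B by auto
    have g': "g z = h None" "g b = h (Some b)" "g u = h (Some u)" "g v = h (Some v)"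
      using g(2) z b uv by auto
    \<comment> \<open>Under \<open>g\<close> both pairs become \<open>h\<close>-images of abstract
      pairs with the same \<open>p\<close>-value \<open>r b\<close>, so reflexivity of
      \<open>R\<close> suffices.\<close>
    have "((b, z), (u, v)) \<in> R" "((u, v), (b, z)) \<in> R"
      using refl[of "(u, v)"] F z b uv
      by (subst gR; simp add: g' hR p)+
    then show ?thesis using ech_quot_eq_iff[of "(b, z)" "(u, v)"] F z uv by auto
  qed
  then show thesis using that z(1) zB by blast
qed

lemma ech_Fraisse_limit_extension:
  assumes univ: "ech_universal F R" and hom: "ech_homogeneous F R"
  shows "cg_extension (ech_colours F R) F (ech_colouring R)"
  unfolding cg_extension_def
proof (intro allI impI, elim conjE)
  fix A c assume A: "finite A" "A \<subseteq> F" "c \<in> A \<rightarrow> ech_colours F R"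
  show "\<exists>z\<in>F - A. \<forall>a\<in>A. ech_colouring R {a, z} = c a"
  \<comment> \<open>The default \<open>a0\<close> below has to be a point of \<open>A\<close>. For
    empty \<open>A\<close> any point of the non-empty \<open>F\<close> will do.\<close>
  proof (cases "A = {}")
    case True
    then show ?thesis using ech unfolding echeloned_space_def by blast
  next
    case False
    then obtain a0 where a0: "a0 \<in> A" by blast
    have "\<forall>a\<in>A. \<exists>q. q \<in> F \<times> F \<and> fst q \<noteq> snd q \<and> c a = ech_quot R q"
      using A(3) unfolding ech_colours_eq by fastforce
    then obtain q where q: "\<And>a. a \<in> A \<Longrightarrow> q a \<in> F \<times> F" "\<And>a. a \<in> A \<Longrightarrow> fst (q a) \<noteq> snd (q a)"
      "\<And>a. a \<in> A \<Longrightarrow> c a = ech_quot R (q a)" by metis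
    \<comment> \<open>Adding the coordinates of the representatives places every \<open>q a\<close>
      in \<open>B \<times> B\<close>.\<close>
    define B where "B = A \<union> fst ` q ` A \<union> snd ` q ` A"
    \<comment> \<open>Points of \<open>B\<close> outside \<open>A\<close> carry no prescribed
      colour; they get the pair chosen for \<open>a0\<close>.\<close>
    define r where "r b = q (if b \<in> A then b else a0)" for b
    have B: "finite B" "B \<subseteq> F" "a0 \<in> B"
      using A a0 q(1) unfolding B_def by (auto simp: mem_Times_iff)
    have r: "r b \<in> B \<times> B" "fst (r b) \<noteq> snd (r b)" for b
      using a0 q(2) unfolding B_def r_def by (auto simp: mem_Times_iff)
    obtain z where z: "z \<in> F - B" "\<And>b. b \<in> B \<Longrightarrow> ech_quot R (b, z) = ech_quot R (r b)"
      by (rule ech_one_point_extension[OF univ hom B, of r]) (use r in blast)+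
    have "ech_colouring R {a, z} = c a" if a: "a \<in> A" for a
    proof -
      have "a \<in> B" "r a = q a" using a by (auto simp: B_def r_def)
      then show ?thesis
        using ech_colouring_eq[of a z] z B(2) q(3)[OF a] by auto
    qed
    then show ?thesis using z(1) unfolding B_def by blast
  qed
qed

end

text \<open>Embed the two-point space in which all pairs off the diagonal are equivalent. The
  resulting points provide the colour that \<open>coloured_graph\<close> asks for.\<close>

lemma ech_universal_two_points:
  assumes "ech_universal F R"
  obtains x y where "x \<in> F" "y \<in> F" "x \<noteq> y"
proof -
  let ?Y = "{0, 1 :: nat}"
  let ?S = "{((x, y), (u, v)). x \<in> ?Y \<and> y \<in> ?Y \<and> u \<in> ?Y \<and> v \<in> ?Y \<and> (x = y \<or> u \<noteq> v)}"
  have "echeloned_space ?Y ?S"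
    unfolding echeloned_space_def preorder_on_def refl_on_def total_on_def
    by (auto intro!: transI)
  then obtain h where "ech_embedding ?Y ?S F R h"
    using ech_universal_embedding[OF assms] by blast
  then show thesis
    using that[of "h 0" "h 1"] unfolding ech_embedding_def inj_on_def by auto
qed

theorem theorem3p17:
  fixes F :: "'a set" and R :: "('a \<times> 'a) rel"
  assumes "ech_Fraisse_limit F R"
  shows "cg_Fraisse_limit (ech_colours F R) F (ech_colouring R) \<and>
    (\<forall>(V :: 'b set) \<psi>. cg_Fraisse_limit (ech_colours F R) V \<psi> \<longrightarrow>
       cg_isomorphic F (ech_colouring R) V \<psi>)"
proof -
  have F: "echeloned_space F R" "countable F" "ech_universal F R" "ech_homogeneous F R"
    using assms unfolding ech_Fraisse_limit_def by auto
  have ext: "cg_extension (ech_colours F R) F (ech_colouring R)"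
    using ech_Fraisse_limit_extension F by blast
  have graph: "coloured_graph (ech_colours F R) F (ech_colouring R)"
    using ech_universal_two_points[OF F(3)] ech_coloured_graph[OF F(1)] by blast
  have "cg_isomorphic F (ech_colouring R) V \<psi>"
    if V: "cg_Fraisse_limit (ech_colours F R) V \<psi>" for V :: "'b set" and \<psi>
  proof -
    \<comment> \<open>Both graphs have the extension property, so the back-and-forth can start from
      nothing.\<close>
    have "cg_partial_iso F (ech_colouring R) V \<psi> {}" by (simp add: cg_partial_iso_def)
    with V show ?thesis
      using cg_partial_iso_extends[OF ext graph F(2) cg_Fraisse_limit_imp_extension[OF V]]
      unfolding cg_Fraisse_limit_def cg_isomorphic_def by (metis finite.emptyI)
  qed
  then show ?thesis
    using cg_extension_imp_Fraisse_limit[OF ext graph F(2)] by blast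
qed

end
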